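(* Let $F:\mathbb{R}^n\to\mathbb{R}^n$ be continuously differentiable with Jacobian $J(x)$, and let $f(x)=\frac12\|F(x)\|^2$. Let $x_0\in\mathbb{R}^n$ be the starting point and $\tau$ the constant bounding $\sum_k\tau_k$ in Algorithm 1 (the hybrid+ method described in the context). Assume that: (1) the level set $\Theta_0=\{x\in\mathbb{R}^n: f(x)\le f(x_0)+\tau\}$ is bounded, and there exists $\bar x\in\mathbb{R}^n$ with $F(\bar x)=0$; (2) there are a set $\tilde\Theta\supseteq\Theta_0$ and a constant $\mathcal{L}>0$ such that $\|J(x)-J(y)\|\le\mathcal{L}\|x-y\|$ for all $x,y\in\tilde\Theta$. Let $\{x_k\}_{k\ge0}$ be an infinite sequence generated by Algorithm 1, with associated diagonal matrices $B_k$. Then either $$\liminf_{k\to\infty}\|F(x_k)\|=0,$$ or $$\liminf_{k\to\infty}\langle J(x_k)^TF(x_k),\,B_kF(x_k)\rangle=0.$$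
   Context: $\|\cdot\|$ is the Euclidean norm (and the induced matrix norm) and $\langle\cdot,\cdot\rangle$ the standard inner product on $\mathbb{R}^n$. The merit function is $f(x):=\frac12\|F(x)\|^2$. Superscript $i$ on a vector denotes its $i$th component. "Either ... or" is inclusive. Algorithm 1 (hybrid+). Input: $x_0\in\mathbb{R}^n$; constants $\rho,\sigma,\eta_{\min},\eta_{\max}\in(0,1)$ with $\eta_{\min}\le\eta_{\max}$; $\mathrm{tol}>0$; $0<\ell\le 1\le u$; a sequence of positive numbers $\{\tau_k\}$ with $\sum_{k=0}^\infty\tau_k\le\tau<\infty$. Set $k=0$, $B_0=I$, $C_0=f(x_0)$, $Q_0=1$. Step 1: If $\|F(x_k)\|\le\mathrm{tol}$, stop. Step 2: If $k=0$, set $d_0=-F(x_0)$. If $k\ge1$, set $y_{k-1}=F(x_k)-F(x_{k-1})$, $s_{k-1}=x_k-x_{k-1}$, and $$d_k=-B_kF(x_k)+\bar\beta_k d_{k-1},\qquad B_k=\mathrm{diag}\Big(\frac1{b_k^1},\dots,\frac1{b_k^n}\Big),$$ where $b_k^i=\max\{\min\{y_{k-1}^i/s_{k-1}^i,\,u\},\,\ell\}$ if $s_{k-1}^i\ne0$, $b_k^i=1$ if $s_{k-1}^i=0$, and $$\bar\beta_k=\frac{\max\{0,\langle F(x_k),y_{k-1}\rangle\}}{\max\{\langle d_{k-1},y_{k-1}\rangle,\ \|F(x_{k-1})\|^2\}}.$$ Step 3: Set $\lambda_k=1$. Step 4: If $f(x_k+\lambda_kd_k)\le C_k+\tau_k-\sigma\lambda_k^2\|d_k\|^2$,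 set $x_{k+1}=x_k+\lambda_kd_k$. Else, if $f(x_k-\lambda_kd_k)\le C_k+\tau_k-\sigma\lambda_k^2\|d_k\|^2$, set $x_{k+1}=x_k-\lambda_kd_k$. Otherwise replace $\lambda_k$ by $\rho\lambda_k$ and repeat Step 4. Step 5: Choose $\eta_k\in[\eta_{\min},\eta_{\max}]$ and compute $$Q_{k+1}=\eta_kQ_k+1,\qquad C_{k+1}=\frac{\eta_kQ_k(C_k+\tau_k)+f(x_{k+1})}{Q_{k+1}}.$$ Step 6: Set $k=k+1$ and go to Step 1. The sequence is infinite, i.e. the stopping test in Step 1 is never triggered. *)

theory Defs
  imports "HOL-Analysis.Analysis"
begin

definition merit :: "(real^'n \<Rightarrow> real^'n) \<Rightarrow> real^'n \<Rightarrow> real" where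
  "merit F x = (1/2) * (norm (F x))\<^sup>2"

text \<open>The norm of the type \<^typ>\<open>real^'n^'m\<close> in the library is the Frobenius norm; the matrix
  norm induced by the Euclidean norm is the operator norm of the associated linear map.\<close>

definition induced_norm :: "real^'n^'m \<Rightarrow> real" where
  "induced_norm A = onorm (\<lambda>v. A *v v)"

definition diag_matrix :: "real^'n \<Rightarrow> real^'n^'n" where
  "diag_matrix v = (\<chi> i j. if i = j then v $ i else 0)"

definition scaling_coeffs :: "real \<Rightarrow> real \<Rightarrow> real^'n \<Rightarrow> real^'n \<Rightarrow> real^'n" where
  "scaling_coeffs l u s y =
     (\<chi> i. if s $ i \<noteq> 0 then max (min (y $ i / s $ i) u) l else 1)"

definition scaling_matrix :: "real \<Rightarrow> real \<Rightarrow> real^'n \<Rightarrow> real^'n \<Rightarrow> real^'n^'n" where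
  "scaling_matrix l u s y = diag_matrix (\<chi> i. 1 / scaling_coeffs l u s y $ i)"

text \<open>\<open>G\<close> and \<open>G'\<close> are the values of \<open>F\<close> at the previous and at the current iterate,
  and \<open>d\<close> is the previous direction.\<close>

definition cg_coeff :: "real^'n \<Rightarrow> real^'n \<Rightarrow> real^'n \<Rightarrow> real" where
  "cg_coeff G G' d =
     max 0 (G' \<bullet> (G' - G)) / max (d \<bullet> (G' - G)) ((norm G)\<^sup>2)"

definition accepts ::
  "(real^'n \<Rightarrow> real^'n) \<Rightarrow> real \<Rightarrow> real \<Rightarrow> real^'n \<Rightarrow> real \<Rightarrow> real^'n \<Rightarrow> bool" where
  "accepts F \<sigma> c d t z \<longleftrightarrow> merit F z \<le> c - \<sigma> * t\<^sup>2 * (norm d)\<^sup>2"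

text \<open>The backtracking loop, started at \<open>x\<close> with direction \<open>d\<close> and reference value \<open>c\<close>, ends with
  step length \<open>t\<close> and new iterate \<open>x'\<close>: every earlier trial length \<open>\<rho> ^ i\<close> was rejected in both
  directions, and the backward step is only taken if the forward one is rejected.\<close>

definition line_search ::
  "(real^'n \<Rightarrow> real^'n) \<Rightarrow> real \<Rightarrow> real \<Rightarrow> real \<Rightarrow> real^'n \<Rightarrow> real^'n \<Rightarrow> real \<Rightarrow> real^'n \<Rightarrow> bool" where
  "line_search F \<rho> \<sigma> c x d t x' \<longleftrightarrow>
     (\<exists>j. t = \<rho> ^ j \<and>
        (\<forall>i<j. \<not> accepts F \<sigma> c d (\<rho> ^ i) (x + \<rho> ^ i *\<^sub>R d) \<and>
               \<not> accepts F \<sigma> c d (\<rho> ^ i) (x - \<rho> ^ i *\<^sub>R d))) \<and>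
     (if accepts F \<sigma> c d t (x + t *\<^sub>R d)
      then x' = x + t *\<^sub>R d
      else accepts F \<sigma> c d t (x - t *\<^sub>R d) \<and> x' = x - t *\<^sub>R d)"

text \<open>An infinite run of the algorithm, in which the stopping test is never satisfied.
  Only the parameters \<open>\<eta> k\<close> are freely chosen along the run; the sequences \<open>B\<close>, \<open>d\<close>,
  \<open>t\<close> (step lengths), \<open>C\<close>, \<open>Q\<close> are then determined together with the iterates \<open>x\<close>.\<close>

definition hybrid_plus_run ::
  "(real^'n \<Rightarrow> real^'n) \<Rightarrow> real \<Rightarrow> real \<Rightarrow> real \<Rightarrow> real \<Rightarrow> real \<Rightarrow> real \<Rightarrow> real \<Rightarrow> (nat \<Rightarrow> real)
   \<Rightarrow> real^'n \<Rightarrow> (nat \<Rightarrow> real^'n) \<Rightarrow> (nat \<Rightarrow> real^'n^'n) \<Rightarrow> (nat \<Rightarrow> real^'n) \<Rightarrow> (nat \<Rightarrow> real)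
   \<Rightarrow> (nat \<Rightarrow> real) \<Rightarrow> (nat \<Rightarrow> real) \<Rightarrow> (nat \<Rightarrow> real) \<Rightarrow> bool" where
  "hybrid_plus_run F \<rho> \<sigma> \<eta>min \<eta>max tol l u \<tau>s x0 x B d t \<eta> C Q \<longleftrightarrow>
     x 0 = x0 \<and> B 0 = mat 1 \<and> C 0 = merit F x0 \<and> Q 0 = 1 \<and> d 0 = - F x0 \<and>
     (\<forall>k. \<not> norm (F (x k)) \<le> tol) \<and>
     (\<forall>k. B (Suc k) = scaling_matrix l u (x (Suc k) - x k) (F (x (Suc k)) - F (x k))) \<and>
     (\<forall>k. d (Suc k) = - (B (Suc k) *v F (x (Suc k)))
                      + cg_coeff (F (x k)) (F (x (Suc k))) (d k) *\<^sub>R d k) \<and>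
     (\<forall>k. line_search F \<rho> \<sigma> (C k + \<tau>s k) (x k) (d k) (t k) (x (Suc k))) \<and>
     (\<forall>k. \<eta> k \<in> {\<eta>min..\<eta>max}) \<and>
     (\<forall>k. Q (Suc k) = \<eta> k * Q k + 1) \<and>
     (\<forall>k. C (Suc k) = (\<eta> k * Q k * (C k + \<tau>s k) + merit F (x (Suc k))) / Q (Suc k))"

end

theory Submission
  imports Defs
begin

text \<open>
  The stopping test keeps \<open>norm (F (x k))\<close> above \<open>tol\<close>, so the first alternative never occurs on an
  infinite run: the content is the second one, and the inner product in fact tends to \<open>0\<close> along
  the whole sequence. Write \<open>g z = transpose (J z) *v F z\<close>, the gradient of the merit function, and
  \<open>p k = B k *v F (x k)\<close>.

  \<^item> Averaging the reference values \<open>C k\<close> costs nothing: they still dominate the merit values and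
    decrease up to the summable slack, by a fixed fraction of \<open>(t k * norm (d k))\<^sup>2\<close>
    (\<open>nonmonotone_reference_values\<close>). So the iterates stay in the bounded level set and
    \<open>t k * norm (d k)\<close>, the length of the step, tends to \<open>0\<close>.

  \<^item> On a bounded set \<open>F\<close> is bounded and uniformly continuous, so \<open>F (x (k+1)) - F (x k)\<close> tends
    to \<open>0\<close>. The denominator of the conjugate gradient coefficient is at least \<open>tol\<^sup>2\<close>, so the
    coefficient tends to \<open>0\<close>. Hence the directions are bounded and \<open>d k + p k\<close> tends to \<open>0\<close>
    (\<open>damped_recursion_tendsto\<close>): asymptotically \<open>d k\<close> is the scaled residual direction.

  \<^item> The diagonal entries of \<open>B k\<close> are at least \<open>1/u\<close>, so \<open>p k\<close>, and with it \<open>d k\<close>, stays away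
    from \<open>0\<close>. As \<open>t k * norm (d k)\<close> vanishes, \<open>t k\<close> tends to \<open>0\<close>; so eventually the line search
    backtracks, and the trial length \<open>t k / \<rho>\<close> was rejected in both directions.

  \<^item> Rejection forwards bounds the slope \<open>g (x k) \<bullet> d k\<close> from below by a quantity tending to \<open>0\<close>,
    and rejection backwards bounds it from above in the same way
    (\<open>slope_tendsto_0_if_no_decrease_both_ways\<close>). So \<open>g (x k) \<bullet> d k\<close> tends to \<open>0\<close>, and so does
    \<open>g (x k) \<bullet> p k\<close>, because \<open>d k + p k\<close> does and \<open>g (x k)\<close> is bounded.
\<close>

section \<open>Continuously differentiable maps on bounded sets\<close>

lemma merit_has_derivative:
  fixes F :: "real^'n \<Rightarrow> real^'n"
  assumes "(F has_derivative (\<lambda>h. A *v h)) (at z)"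
  shows "(merit F has_derivative (\<lambda>h. (transpose A *v F z) \<bullet> h)) (at z)"
proof -
  have "(merit F has_derivative (\<lambda>h. (1/2) * (F z \<bullet> (A *v h) + (A *v h) \<bullet> F z))) (at z)"
    unfolding merit_def[abs_def] power2_norm_eq_inner
    by (intro has_derivative_mult_right has_derivative_inner assms)
  moreover have "(1/2) * (F z \<bullet> (A *v h) + (A *v h) \<bullet> F z) = (transpose A *v F z) \<bullet> h" for h
    by (simp add: inner_commute[of "A *v h"] dot_lmul_matrix)
  ultimately show ?thesis by simp
qed

text \<open>The gradient is uniformly continuous on a ball slightly larger than \<open>S\<close>, and for short \<open>v\<close>
  that ball contains the segment from \<open>z\<close> to \<open>z + v\<close>; the mean value inequality along this segment
  then gives one \<open>\<delta>\<close> for all points of \<open>S\<close>.\<close>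

lemma uniform_first_order_expansion:
  fixes f :: "'a::euclidean_space \<Rightarrow> real" and g :: "'a \<Rightarrow> 'a"
  assumes der: "\<And>z. (f has_derivative (\<lambda>h. g z \<bullet> h)) (at z)"
    and cont: "continuous_on UNIV g" and "bounded S" and "\<epsilon> > 0"
  obtains \<delta> where "\<delta> > 0"
    "\<And>z v. z \<in> S \<Longrightarrow> norm v < \<delta> \<Longrightarrow> \<bar>f (z + v) - f z - g z \<bullet> v\<bar> \<le> \<epsilon> * norm v"
proof -
  obtain r where r: "\<And>z. z \<in> S \<Longrightarrow> norm z \<le> r"
    using \<open>bounded S\<close> by (auto simp: bounded_iff)
  have "uniformly_continuous_on (cball 0 (r + 1)) g"
    using cont by (intro compact_uniformly_continuous) (auto intro: continuous_on_subset)
  then obtain \<delta>0 where \<delta>0: "\<delta>0 > 0"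
    "\<And>y z. y \<in> cball 0 (r + 1) \<Longrightarrow> z \<in> cball 0 (r + 1) \<Longrightarrow> dist y z < \<delta>0 \<Longrightarrow> dist (g y) (g z) < \<epsilon>"
    using \<open>\<epsilon> > 0\<close> unfolding uniformly_continuous_on_def by metis
  show thesis
  proof (rule that)
    show "min 1 \<delta>0 > 0" using \<delta>0 by simp
  next
    fix z v :: 'a assume z: "z \<in> S" and v: "norm v < min 1 \<delta>0"
    have seg: "z + s *\<^sub>R v \<in> cball 0 (r + 1)" "dist (z + s *\<^sub>R v) z < \<delta>0" if "s \<in> {0..1}" for s
    proof -
      have le: "norm (s *\<^sub>R v) \<le> norm v" using that by (simp add: mult_left_le_one_le)
      then show "z + s *\<^sub>R v \<in> cball 0 (r + 1)"
        using norm_triangle_ineq[of z "s *\<^sub>R v"] r[OF z] v by simp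
      show "dist (z + s *\<^sub>R v) z < \<delta>0" using le v by (simp add: dist_norm)
    qed
    have "norm (f (z + v) - f z - g z \<bullet> (z + v - z)) \<le> norm (z + v - z) * \<epsilon>"
    proof (rule differentiable_bound_linearization[where S = "(\<lambda>s. z + s *\<^sub>R v) ` {0..1}"
          and f' = "\<lambda>y h. g y \<bullet> h" and ?x0.0 = z])
      fix y assume "y \<in> (\<lambda>s. z + s *\<^sub>R v) ` {0..1}"
      then obtain s where s: "s \<in> {0..1}" and y: "y = z + s *\<^sub>R v" by auto
      have "z \<in> cball 0 (r + 1)" using r[OF z] by simp
      then have "norm (g y - g z) \<le> \<epsilon>"
        using \<delta>0(2)[of y z] seg[OF s] unfolding y dist_norm by linarith
      then have "norm ((g y - g z) \<bullet> h) \<le> \<epsilon> * norm h" for h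
        using order_trans[OF Cauchy_Schwarz_ineq2[of "g y - g z" h]]
        by (simp add: mult_right_mono)
      then show "onorm ((\<lambda>h. g y \<bullet> h) - (\<lambda>h. g z \<bullet> h)) \<le> \<epsilon>"
        by (intro onorm_le) (simp add: inner_diff_left)
    next
      show "z \<in> (\<lambda>s. z + s *\<^sub>R v) ` {0..1}" by (rule image_eqI[of _ _ 0]) auto
    qed (use der in \<open>auto intro: has_derivative_at_withinI\<close>)
    then show "\<bar>f (z + v) - f z - g z \<bullet> v\<bar> \<le> \<epsilon> * norm v" by (simp add: mult.commute)
  qed
qed

lemma bounded_image_of_continuous:
  fixes g :: "'a::euclidean_space \<Rightarrow> 'b::real_normed_vector"
  assumes "continuous_on UNIV g" "bounded S"
  shows "bounded (g ` S)"
proof -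
  have "compact (g ` closure S)"
    using assms by (intro compact_continuous_image) (auto intro: continuous_on_subset)
  then show ?thesis
    by (rule bounded_subset[OF compact_imp_bounded]) (use closure_subset in blast)
qed

lemma increments_tendsto_0_of_continuous:
  fixes g :: "'a::euclidean_space \<Rightarrow> 'b::real_normed_vector"
  assumes "continuous_on UNIV g" "bounded (range x)"
    and "(\<lambda>k. norm (x (Suc k) - x k)) \<longlonglongrightarrow> 0"
  shows "(\<lambda>k. norm (g (x (Suc k)) - g (x k))) \<longlonglongrightarrow> 0"
proof -
  have "uniformly_continuous_on (closure (range x)) g"
    using assms by (intro compact_uniformly_continuous) (auto intro: continuous_on_subset)
  moreover have "x k \<in> closure (range x)" for k by (rule subsetD[OF closure_subset]) simp
  ultimately show ?thesis
    using assms(3) unfolding uniformly_continuous_on_sequentially dist_norm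
    by (elim allE[of _ "\<lambda>k. x (Suc k)"] allE[of _ x]) simp
qed

lemma continuous_on_transpose_mult:
  fixes J :: "'a::topological_space \<Rightarrow> real^'n^'m"
  assumes "continuous_on S J" "continuous_on S F"
  shows "continuous_on S (\<lambda>z. transpose (J z) *v F z)"
  unfolding matrix_vector_mult_def transpose_def
  using assms by (intro continuous_on_vec_lambda) (auto intro!: continuous_intros)

section \<open>The diagonal scaling\<close>

lemma diag_matrix_vector_nth: "(diag_matrix a *v v) $ i = a $ i * v $ i"
  by (simp add: diag_matrix_def matrix_vector_mult_def if_distrib[where f = "\<lambda>c. c * _"] cong: if_cong)

text \<open>The default coefficient \<open>1\<close>, used where the step has a zero component, also obeys the
  safeguards because \<open>l \<le> 1 \<le> u\<close>.\<close>

lemma scaling_coeffs_bounds: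
  assumes "l \<le> 1" "1 \<le> u"
  shows "l \<le> scaling_coeffs l u s y $ i" "scaling_coeffs l u s y $ i \<le> u"
  using assms by (auto simp: scaling_coeffs_def)

lemma norm_scaling_matrix_vector_bounds:
  assumes "0 < l" "l \<le> 1" "1 \<le> u"
  shows "norm (scaling_matrix l u s y *v v) \<le> norm v / l"
    and "norm v \<le> u * norm (scaling_matrix l u s y *v v)"
proof -
  let ?b = "scaling_coeffs l u s y" and ?w = "scaling_matrix l u s y *v v"
  have w: "?w $ i = v $ i / ?b $ i" for i
    by (simp add: scaling_matrix_def diag_matrix_vector_nth)
  have b: "l \<le> ?b $ i" "?b $ i \<le> u" for i using scaling_coeffs_bounds assms by blast+
  have "norm ?w \<le> norm ((1/l) *\<^sub>R v)"
  proof (rule norm_le_componentwise_cart)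
    fix i show "norm (?w $ i) \<le> norm (((1/l) *\<^sub>R v) $ i)"
      using b(1)[of i] assms by (simp add: w abs_divide frac_le)
  qed
  then show "norm ?w \<le> norm v / l" using assms by simp
  have "norm v \<le> norm (u *\<^sub>R ?w)"
  proof (rule norm_le_componentwise_cart)
    fix i
    have "0 < ?b $ i" using b(1)[of i] assms by simp
    then have "\<bar>v $ i\<bar> = ?b $ i * \<bar>?w $ i\<bar>" by (simp add: w abs_divide)
    also have "\<dots> \<le> u * \<bar>?w $ i\<bar>" using b(2)[of i] by (intro mult_right_mono) auto
    finally show "norm (v $ i) \<le> norm ((u *\<^sub>R ?w) $ i)" using assms by (simp add: abs_mult)
  qed
  then show "norm v \<le> u * norm ?w" using assms by simp
qed

section \<open>The nonmonotone line search\<close>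

text \<open>Since \<open>\<eta> k * Q k = Q (k+1) - 1\<close>, the new reference value is the convex combination of
  \<open>C k + \<tau>s k\<close> and \<open>\<phi> (k+1)\<close> with weight \<open>1 / Q (k+1)\<close> on the latter. So it lies above
  \<open>\<phi> (k+1)\<close>, and it keeps at least the fraction \<open>1 / Q (k+1)\<close> of the decrease \<open>a k\<close>. The weights
  \<open>Q k\<close> are partial sums dominated by the geometric series in \<open>\<eta>max\<close>, so this fraction is at least
  \<open>1 - \<eta>max\<close>; telescoping then bounds the reference values and the sum of the decreases.\<close>

lemma nonmonotone_reference_values:
  fixes C Q \<eta> \<tau>s \<phi> a :: "nat \<Rightarrow> real"
  assumes "C 0 = \<phi> 0" "Q 0 = 1"
    and Q: "\<And>k. Q (Suc k) = \<eta> k * Q k + 1"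
    and C: "\<And>k. C (Suc k) = (\<eta> k * Q k * (C k + \<tau>s k) + \<phi> (Suc k)) / Q (Suc k)"
    and \<eta>: "\<And>k. 0 \<le> \<eta> k" "\<And>k. \<eta> k \<le> \<eta>max" "\<eta>max < 1"
    and \<phi>: "\<And>k. 0 \<le> \<phi> k" "\<And>k. \<phi> (Suc k) \<le> C k + \<tau>s k - a k"
    and a: "\<And>k. 0 \<le> a k" and \<tau>s: "\<And>k. 0 \<le> \<tau>s k" "summable \<tau>s"
  shows "\<phi> k \<le> C k" and "C k \<le> C 0 + suminf \<tau>s" and "summable a"
proof -
  have Q_bounds: "1 \<le> Q k \<and> (1 - \<eta>max) * Q k \<le> 1" for k
  proof (induction k)
    case 0 show ?case using \<eta>(1)[of 0] \<eta>(2)[of 0] \<open>Q 0 = 1\<close> by simp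
  next
    case (Suc k)
    have "0 \<le> \<eta> k * Q k" using Suc \<eta>(1)[of k] by simp
    moreover have "(1 - \<eta>max) * (\<eta> k * Q k) \<le> \<eta>max * 1"
    proof -
      have "\<eta> k * ((1 - \<eta>max) * Q k) \<le> \<eta>max * 1"
        using Suc \<eta>(1)[of k] \<eta>(2)[of k] \<eta>(3) by (intro mult_mono) auto
      then show ?thesis by (simp add: algebra_simps)
    qed
    ultimately show ?case by (simp add: Q algebra_simps)
  qed
  have mean: "C (Suc k) = C k + \<tau>s k - (C k + \<tau>s k - \<phi> (Suc k)) / Q (Suc k)" for k
  proof -
    have "Q (Suc k) > 0" using Q_bounds[of "Suc k"] by simp
    moreover have e: "\<eta> k * Q k = Q (Suc k) - 1" by (simp add: Q)
    ultimately show ?thesis unfolding C e by (simp add: field_simps)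
  qed
  have step: "C (Suc k) + (1 - \<eta>max) * a k \<le> C k + \<tau>s k" for k
  proof -
    have q: "0 < Q (Suc k)" "1 - \<eta>max \<le> 1 / Q (Suc k)"
      using Q_bounds[of "Suc k"] by (auto simp: field_simps)
    have "(1 - \<eta>max) * a k \<le> 1 / Q (Suc k) * (C k + \<tau>s k - \<phi> (Suc k))"
      using q \<phi>(2)[of k] a[of k] \<eta>(3) by (intro mult_mono) auto
    then show ?thesis by (simp add: mean)
  qed
  have le: "\<phi> k \<le> C k" for k
  proof (cases k)
    case 0 then show ?thesis using \<open>C 0 = \<phi> 0\<close> by simp
  next
    case (Suc m)
    have "C m + \<tau>s m - \<phi> (Suc m) \<ge> 0" using \<phi>(2)[of m] a[of m] by simp
    then have "(C m + \<tau>s m - \<phi> (Suc m)) / Q (Suc m) \<le> C m + \<tau>s m - \<phi> (Suc m)"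
      using Q_bounds[of "Suc m"] by (simp add: divide_le_eq mult_le_cancel_left1)
    then show ?thesis using Suc mean[of m] by simp
  qed
  then show "\<phi> k \<le> C k" .
  have tele: "C n + (1 - \<eta>max) * (\<Sum>k<n. a k) \<le> C 0 + (\<Sum>k<n. \<tau>s k)" for n
  proof (induction n)
    case (Suc n)
    then show ?case using step[of n] by (simp add: distrib_left)
  qed simp
  have tau_le: "(\<Sum>k<n. \<tau>s k) \<le> suminf \<tau>s" for n
    using \<tau>s by (intro sum_le_suminf) auto
  have "0 \<le> (1 - \<eta>max) * (\<Sum>i<k. a i)" using a \<eta>(3) by (intro mult_nonneg_nonneg sum_nonneg) auto
  then show "C k \<le> C 0 + suminf \<tau>s" using tele[of k] tau_le[of k] by linarith
  show "summable a"
  proof (rule summableI_nonneg_bounded)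
    show "0 \<le> a n" for n by (rule a)
    fix n
    have "(1 - \<eta>max) * (\<Sum>k<n. a k) \<le> C 0 + suminf \<tau>s"
      using tele[of n] tau_le[of n] le[of n] \<phi>(1)[of n] by linarith
    then show "(\<Sum>k<n. a k) \<le> (C 0 + suminf \<tau>s) / (1 - \<eta>max)"
      using \<eta>(3) by (simp add: pos_le_divide_eq mult.commute)
  qed
qed

text \<open>The last two conclusions record the last rejected trial length \<open>t / \<rho>\<close>, which exists as soon
  as the initial length \<open>1\<close> is not taken.\<close>

lemma line_search_step:
  assumes "line_search F \<rho> \<sigma> c x d t x'" and "0 < \<rho>" "\<rho> < 1"
  shows "merit F x' \<le> c - \<sigma> * t\<^sup>2 * (norm d)\<^sup>2"
    and "norm (x' - x) = t * norm d" and "0 < t"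
    and "t < 1 \<Longrightarrow> c - \<sigma> * (norm ((t / \<rho>) *\<^sub>R d))\<^sup>2 < merit F (x + (t / \<rho>) *\<^sub>R d)"
    and "t < 1 \<Longrightarrow> c - \<sigma> * (norm ((t / \<rho>) *\<^sub>R d))\<^sup>2 < merit F (x - (t / \<rho>) *\<^sub>R d)"
proof -
  obtain j where t: "t = \<rho> ^ j"
    and rej: "\<And>i. i < j \<Longrightarrow> \<not> accepts F \<sigma> c d (\<rho> ^ i) (x + \<rho> ^ i *\<^sub>R d) \<and>
                       \<not> accepts F \<sigma> c d (\<rho> ^ i) (x - \<rho> ^ i *\<^sub>R d)"
    using assms(1) unfolding line_search_def by blast
  have acc: "accepts F \<sigma> c d t x'" and x': "x' = x + t *\<^sub>R d \<or> x' = x - t *\<^sub>R d"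
    using assms(1) unfolding line_search_def by (auto split: if_splits)
  show "0 < t" using t assms by simp
  then show "norm (x' - x) = t * norm d" using x' by auto
  show "merit F x' \<le> c - \<sigma> * t\<^sup>2 * (norm d)\<^sup>2" using acc by (simp add: accepts_def)
  assume "t < 1"
  then obtain i where i: "j = Suc i" using t by (cases j) auto
  have "t / \<rho> = \<rho> ^ i" using assms by (simp add: t i)
  then show "c - \<sigma> * (norm ((t / \<rho>) *\<^sub>R d))\<^sup>2 < merit F (x + (t / \<rho>) *\<^sub>R d)"
    and "c - \<sigma> * (norm ((t / \<rho>) *\<^sub>R d))\<^sup>2 < merit F (x - (t / \<rho>) *\<^sub>R d)"
    using rej[of i] assms i by (auto simp: accepts_def power_mult_distrib mult.assoc)
qed

text \<open>Without a decrease beyond second order along \<open>v\<close>, the slope along \<open>v\<close> cannot be substantially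
  negative; the same along \<open>-v\<close> shows that it cannot be substantially positive. The uniform
  expansion makes both bounds independent of the base point.\<close>

lemma slope_tendsto_0_if_no_decrease_both_ways:
  fixes f :: "'a::euclidean_space \<Rightarrow> real" and g :: "'a \<Rightarrow> 'a" and z v :: "nat \<Rightarrow> 'a"
  assumes der: "\<And>z. (f has_derivative (\<lambda>h. g z \<bullet> h)) (at z)"
    and cont: "continuous_on UNIV g" and bdd: "bounded (range z)" and v: "v \<longlonglongrightarrow> 0"
    and fwd: "eventually (\<lambda>k. f (z k) - \<sigma> * (norm (v k))\<^sup>2 \<le> f (z k + v k)) sequentially"
    and bwd: "eventually (\<lambda>k. f (z k) - \<sigma> * (norm (v k))\<^sup>2 \<le> f (z k - v k)) sequentially"
  shows "(\<lambda>k. (g (z k) \<bullet> v k) / norm (v k)) \<longlonglongrightarrow> 0"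
proof (rule tendstoI)
  fix \<epsilon> :: real assume "\<epsilon> > 0"
  then obtain \<delta> where "\<delta> > 0" and \<delta>: "\<And>y h. y \<in> range z \<Longrightarrow> norm h < \<delta> \<Longrightarrow>
      \<bar>f (y + h) - f y - g y \<bullet> h\<bar> \<le> \<epsilon> / 2 * norm h"
    using uniform_first_order_expansion[OF der cont bdd, of "\<epsilon> / 2"] by auto
  have "eventually (\<lambda>k. norm (v k) < \<delta>) sequentially"
    using tendsto_norm_zero[OF v] \<open>\<delta> > 0\<close> by (rule order_tendstoD)
  moreover have "eventually (\<lambda>k. \<sigma> * norm (v k) < \<epsilon> / 2) sequentially"
    using tendsto_mult_right_zero[OF tendsto_norm_zero[OF v], of \<sigma>] \<open>\<epsilon> > 0\<close>
    by (intro order_tendstoD(2)) auto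
  ultimately show "eventually (\<lambda>k. dist ((g (z k) \<bullet> v k) / norm (v k)) 0 < \<epsilon>) sequentially"
    using fwd bwd
  proof eventually_elim
    case (elim k)
    show ?case
    proof (cases "v k = 0")
      case False
      have "\<bar>g (z k) \<bullet> v k\<bar> \<le> \<epsilon> / 2 * norm (v k) + \<sigma> * (norm (v k))\<^sup>2"
      proof (rule abs_leI)
        show "g (z k) \<bullet> v k \<le> \<epsilon> / 2 * norm (v k) + \<sigma> * (norm (v k))\<^sup>2"
          using \<delta>[of "z k" "- v k", THEN abs_le_D1] elim by simp
        show "- (g (z k) \<bullet> v k) \<le> \<epsilon> / 2 * norm (v k) + \<sigma> * (norm (v k))\<^sup>2"
          using \<delta>[of "z k" "v k", THEN abs_le_D1] elim by simp
      qed
      also have "\<dots> = (\<epsilon> / 2 + \<sigma> * norm (v k)) * norm (v k)"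
        by (simp add: algebra_simps power2_eq_square)
      also have "\<dots> < \<epsilon> * norm (v k)" using elim False by (intro mult_strict_right_mono) auto
      finally show ?thesis using False by (simp add: abs_divide divide_less_eq)
    qed (use \<open>\<epsilon> > 0\<close> in simp)
  qed
qed

section \<open>Asymptotics of the search directions\<close>

text \<open>Once \<open>\<beta> k \<le> 1/2\<close>, a step at least halves \<open>norm (d k)\<close> before adding at most \<open>M\<close>, so the norms cannot
  exceed their value at that time by more than the fixed point \<open>2 * M\<close>. Boundedness of \<open>d\<close> in turn
  makes \<open>\<beta> k * norm (d k)\<close> vanish.\<close>

lemma damped_recursion_tendsto:
  fixes d p :: "nat \<Rightarrow> 'a::real_normed_vector"
  assumes step: "\<And>k. norm (d (Suc k) + p (Suc k)) \<le> \<beta> k * norm (d k)"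
    and "\<beta> \<longlonglongrightarrow> 0" and p: "\<And>k. norm (p (Suc k)) \<le> M"
  shows "Bseq d" and "(\<lambda>k. d k + p k) \<longlonglongrightarrow> 0"
proof -
  have "eventually (\<lambda>k. \<beta> k < 1/2) sequentially"
    using \<open>\<beta> \<longlonglongrightarrow> 0\<close> by (rule order_tendstoD) simp
  then obtain N where N: "\<And>k. k \<ge> N \<Longrightarrow> \<beta> k < 1/2" by (auto simp: eventually_sequentially)
  have "M \<ge> 0" using p[of 0] norm_ge_zero order_trans by blast
  have "norm (d (k + N)) \<le> norm (d N) + 2 * M" for k
  proof (induction k)
    case 0 then show ?case using \<open>M \<ge> 0\<close> by simp
  next
    case (Suc k)
    have "norm (d (Suc (k + N))) \<le> norm (d (Suc (k + N)) + p (Suc (k + N))) + norm (p (Suc (k + N)))"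
      using norm_triangle_ineq4[of "d (Suc (k + N)) + p (Suc (k + N))" "p (Suc (k + N))"] by simp
    also have "\<dots> \<le> \<beta> (k + N) * norm (d (k + N)) + M" using step p add_mono by blast
    also have "\<beta> (k + N) * norm (d (k + N)) \<le> 1/2 * norm (d (k + N))"
      using N[of "k + N"] by (intro mult_right_mono) auto
    finally show ?case using Suc norm_ge_zero[of "d N"] by (simp; linarith)
  qed
  then have "Bseq (\<lambda>k. d (k + N))" by (rule BseqI')
  then show "Bseq d" by (rule Bseq_offset)
  then obtain D where D: "\<And>k. norm (d k) \<le> D" by (auto simp: Bseq_def)
  have "(\<lambda>k. \<beta> k * norm (d k)) \<longlonglongrightarrow> 0"
    using \<open>\<beta> \<longlonglongrightarrow> 0\<close> D by (intro lim_null_mult_right_bounded[where B = D]) auto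
  with always_eventually[OF allI[OF step]] have "(\<lambda>k. d (Suc k) + p (Suc k)) \<longlonglongrightarrow> 0"
    by (rule Lim_null_comparison)
  then show "(\<lambda>k. d k + p k) \<longlonglongrightarrow> 0" by (rule LIMSEQ_imp_Suc)
qed

section \<open>Convergence of the method\<close>

theorem theorem3p5:
  fixes F :: "real^'n \<Rightarrow> real^'n"
    and J :: "real^'n \<Rightarrow> real^'n^'n"
    and \<rho> \<sigma> \<eta>min \<eta>max tol l u \<tau> L :: real
    and \<tau>s t \<eta> C Q :: "nat \<Rightarrow> real"
    and x0 :: "real^'n"
    and x d :: "nat \<Rightarrow> real^'n"
    and B :: "nat \<Rightarrow> real^'n^'n"
    and \<Theta>0 \<Theta> :: "(real^'n) set"
  assumes deriv: "\<And>z. (F has_derivative (\<lambda>h. J z *v h)) (at z)"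
    and cont: "continuous_on UNIV J"
    and rho: "\<rho> \<in> {0<..<1}" and sigma: "\<sigma> \<in> {0<..<1}"
    and eta: "\<eta>min \<in> {0<..<1}" "\<eta>max \<in> {0<..<1}" "\<eta>min \<le> \<eta>max"
    and tol: "tol > 0"
    and bounds: "0 < l" "l \<le> 1" "1 \<le> u"
    and tau: "\<And>k. \<tau>s k > 0" "summable \<tau>s" "(\<Sum>k. \<tau>s k) \<le> \<tau>"
    and level: "\<Theta>0 = {z. merit F z \<le> merit F x0 + \<tau>}" "bounded \<Theta>0"
    and root: "\<exists>xbar. F xbar = 0"
    and Lip: "\<Theta>0 \<subseteq> \<Theta>" "L > 0"
      "\<And>y z. y \<in> \<Theta> \<Longrightarrow> z \<in> \<Theta> \<Longrightarrow> induced_norm (J y - J z) \<le> L * norm (y - z)"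
    and run: "hybrid_plus_run F \<rho> \<sigma> \<eta>min \<eta>max tol l u \<tau>s x0 x B d t \<eta> C Q"
  shows "liminf (\<lambda>k. ereal (norm (F (x k)))) = 0 \<or>
         liminf (\<lambda>k. ereal ((transpose (J (x k)) *v F (x k)) \<bullet> (B k *v F (x k)))) = 0"
proof -
  let ?f = "merit F" and ?g = "\<lambda>z. transpose (J z) *v F z"
  let ?G = "\<lambda>k. F (x k)" and ?p = "\<lambda>k. B k *v F (x k)"
  let ?\<beta> = "\<lambda>k. cg_coeff (?G k) (?G (Suc k)) (d k)"
  have x_0: "x 0 = x0" and C_x0: "C 0 = ?f x0" and Q_0: "Q 0 = 1"
    and F_gt: "\<And>k. norm (?G k) > tol"
    and B_Suc: "\<And>k. B (Suc k) = scaling_matrix l u (x (Suc k) - x k) (?G (Suc k) - ?G k)"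
    and d_Suc: "\<And>k. d (Suc k) = - ?p (Suc k) + ?\<beta> k *\<^sub>R d k"
    and search: "\<And>k. line_search F \<rho> \<sigma> (C k + \<tau>s k) (x k) (d k) (t k) (x (Suc k))"
    and \<eta>: "\<And>k. \<eta>min \<le> \<eta> k" "\<And>k. \<eta> k \<le> \<eta>max"
    and Q_Suc: "\<And>k. Q (Suc k) = \<eta> k * Q k + 1"
    and C_Suc: "\<And>k. C (Suc k) = (\<eta> k * Q k * (C k + \<tau>s k) + ?f (x (Suc k))) / Q (Suc k)"
    using run unfolding hybrid_plus_run_def not_le atLeastAtMost_iff by blast+
  have C_0: "C 0 = ?f (x 0)" by (simp add: C_x0 x_0)
  note ls = line_search_step[OF search]
  have \<rho>: "0 < \<rho>" "\<rho> < 1" using rho by auto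
  have \<eta>0: "0 \<le> \<eta> k" for k using \<eta>(1)[of k] eta by auto
  have F_cont: "continuous_on UNIV F"
    using deriv by (auto intro!: has_derivative_continuous simp: continuous_on_eq_continuous_within)
  have f_der: "(?f has_derivative (\<lambda>h. ?g z \<bullet> h)) (at z)" for z
    by (rule merit_has_derivative[OF deriv])
  have g_cont: "continuous_on UNIV ?g" by (rule continuous_on_transpose_mult[OF cont F_cont])

  \<comment> \<open>The iterates stay in the level set, and the decreases forced by the line search are summable.\<close>
  define a where "a k = \<sigma> * (t k)\<^sup>2 * (norm (d k))\<^sup>2" for k
  have "?f (x (Suc k)) \<le> C k + \<tau>s k - a k" for k using ls(1)[OF \<rho>] by (simp add: a_def)
  moreover have "0 \<le> a k" for k using sigma by (simp add: a_def)
  moreover have "0 \<le> ?f (x k)" for k by (simp add: merit_def)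
  moreover have "0 \<le> \<tau>s k" for k using tau(1)[of k] by simp
  ultimately have f_le_C: "?f (x k) \<le> C k" and C_le: "C k \<le> C 0 + suminf \<tau>s" and "summable a" for k
    using nonmonotone_reference_values[where \<phi> = "\<lambda>k. ?f (x k)" and a = a,
        OF C_0 Q_0 Q_Suc C_Suc \<eta>0 \<eta>(2)] eta(2) tau(2) by auto
  have "x k \<in> \<Theta>0" for k
    using f_le_C[of k] C_le[of k] tau(3) by (simp add: level(1) C_x0)
  then have x_bdd: "bounded (range x)" by (intro bounded_subset[OF level(2)]) auto

  \<comment> \<open>Vanishing steps make the conjugate gradient coefficient vanish, as its denominator stays above \<open>tol\<^sup>2\<close>.\<close>
  have "(\<lambda>k. a k / \<sigma>) \<longlonglongrightarrow> 0"
    by (rule tendsto_divide_zero[OF summable_LIMSEQ_zero[OF \<open>summable a\<close>]])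
  then have "(\<lambda>k. (t k * norm (d k))\<^sup>2) \<longlonglongrightarrow> 0"
    using sigma by (simp add: a_def power_mult_distrib)
  from tendsto_real_sqrt[OF this] have td: "(\<lambda>k. t k * norm (d k)) \<longlonglongrightarrow> 0"
    using less_imp_le[OF ls(3)[OF \<rho>]] by simp
  then have "(\<lambda>k. norm (x (Suc k) - x k)) \<longlonglongrightarrow> 0" using ls(2)[OF \<rho>] by simp
  then have y: "(\<lambda>k. norm (?G (Suc k) - ?G k)) \<longlonglongrightarrow> 0"
    by (rule increments_tendsto_0_of_continuous[OF F_cont x_bdd])
  obtain M where M: "\<And>k. norm (?G k) \<le> M"
    using bounded_image_of_continuous[OF F_cont x_bdd] by (auto simp: bounded_iff)
  obtain N where N: "\<And>k. norm (?g (x k)) \<le> N"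
    using bounded_image_of_continuous[OF g_cont x_bdd] by (auto simp: bounded_iff)

  have \<beta>_nonneg: "0 \<le> ?\<beta> k" for k by (simp add: cg_coeff_def le_max_iff_disj)
  have "?\<beta> k \<le> norm (?G (Suc k) - ?G k) * (M / tol\<^sup>2)" for k
  proof -
    have "?G (Suc k) \<bullet> (?G (Suc k) - ?G k) \<le> norm (?G (Suc k)) * norm (?G (Suc k) - ?G k)"
      by (rule norm_cauchy_schwarz)
    also have "\<dots> \<le> M * norm (?G (Suc k) - ?G k)" using M by (intro mult_right_mono) auto
    finally have num: "max 0 (?G (Suc k) \<bullet> (?G (Suc k) - ?G k)) \<le> M * norm (?G (Suc k) - ?G k)"
      using order_trans[OF norm_ge_zero M] by simp
    have "tol\<^sup>2 \<le> (norm (?G k))\<^sup>2" using tol F_gt[of k] by (intro power_mono) auto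
    then have "?\<beta> k \<le> M * norm (?G (Suc k) - ?G k) / tol\<^sup>2"
      unfolding cg_coeff_def using num tol by (intro frac_le) (auto simp: le_max_iff_disj)
    then show ?thesis by (simp add: mult.commute)
  qed
  then have \<beta>: "?\<beta> \<longlonglongrightarrow> 0"
    using \<beta>_nonneg by (intro tendsto_0_le[OF y, of _ "M / tol\<^sup>2"]) auto
  have p_le: "norm (?p (Suc k)) \<le> M / l" for k
  proof -
    have "norm (?p (Suc k)) \<le> norm (?G (Suc k)) / l"
      unfolding B_Suc by (rule norm_scaling_matrix_vector_bounds(1)[OF bounds])
    also have "\<dots> \<le> M / l" using M bounds by (intro divide_right_mono) auto
    finally show ?thesis .
  qed
  have p_ge: "tol \<le> u * norm (?p (Suc k))" for k
    unfolding B_Suc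
    using norm_scaling_matrix_vector_bounds(2)[OF bounds] F_gt[of "Suc k"]
    by (rule order_trans[OF less_imp_le, rotated])
  have "norm (d (Suc k) + ?p (Suc k)) \<le> ?\<beta> k * norm (d k)" for k
    using \<beta>_nonneg[of k] by (simp add: d_Suc)
  from damped_recursion_tendsto[where p = ?p, OF this \<beta> p_le]
  have "Bseq d" and dp: "(\<lambda>k. d k + ?p k) \<longlonglongrightarrow> 0" by auto
  then obtain D where D: "\<And>k. norm (d k) \<le> D" by (auto simp: Bseq_def)

  \<comment> \<open>Half of the lower bound \<open>tol / u\<close> for \<open>norm (p k)\<close> is left for \<open>norm (d k)\<close>.
    The index \<open>0\<close> is left out, because \<open>B 0\<close> is not given by the scaling formula.\<close>
  have "eventually (\<lambda>k. norm (d k + ?p k) < tol / (2 * u)) sequentially"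
    using tendsto_norm_zero[OF dp] tol bounds by (intro order_tendstoD(2)) auto
  then have d_ge: "eventually (\<lambda>k. tol / (2 * u) \<le> norm (d k)) sequentially"
    using eventually_gt_at_top[of 0]
  proof eventually_elim
    case (elim k)
    have "tol / u \<le> norm (?p k)"
      using p_ge[of "k - 1"] elim bounds by (simp add: pos_divide_le_eq mult.commute)
    also have "\<dots> \<le> norm (d k + ?p k) + norm (d k)"
      using norm_triangle_ineq4[of "d k + ?p k" "d k"] by simp
    finally show ?case using elim by (simp add: field_simps)
  qed
  have "eventually (\<lambda>k. t k * norm (d k) < tol / (2 * u)) sequentially"
    using td tol bounds by (intro order_tendstoD(2)) auto
  with d_ge have t_lt: "eventually (\<lambda>k. t k < 1) sequentially"
  proof eventually_elim
    case (elim k)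
    then have "t k * norm (d k) < 1 * norm (d k)" by simp
    then show ?case by (rule mult_right_less_imp_less) simp
  qed

  \<comment> \<open>The last rejected trial displacement; dividing the slope along it by its length removes the vanishing
    factor \<open>t k / \<rho>\<close>.\<close>
  define v where "v k = (t k / \<rho>) *\<^sub>R d k" for k
  have "(\<lambda>k. norm (v k)) \<longlonglongrightarrow> 0"
    using tendsto_divide_zero[OF td, of \<rho>] \<rho> less_imp_le[OF ls(3)[OF \<rho>]] by (simp add: v_def)
  then have v: "v \<longlonglongrightarrow> 0" by (rule tendsto_norm_zero_cancel)
  have f_le: "?f (x k) \<le> C k + \<tau>s k" for k using f_le_C[of k] tau(1)[of k] by simp
  have fwd: "eventually (\<lambda>k. ?f (x k) - \<sigma> * (norm (v k))\<^sup>2 \<le> ?f (x k + v k)) sequentially"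
    using t_lt
  proof eventually_elim
    case (elim k)
    show ?case using ls(4)[OF \<rho> elim] f_le[of k] unfolding v_def by linarith
  qed
  have bwd: "eventually (\<lambda>k. ?f (x k) - \<sigma> * (norm (v k))\<^sup>2 \<le> ?f (x k - v k)) sequentially"
    using t_lt
  proof eventually_elim
    case (elim k)
    show ?case using ls(5)[OF \<rho> elim] f_le[of k] unfolding v_def by linarith
  qed
  have "(\<lambda>k. (?g (x k) \<bullet> v k) / norm (v k)) \<longlonglongrightarrow> 0"
    by (rule slope_tendsto_0_if_no_decrease_both_ways[OF f_der g_cont x_bdd v fwd bwd])
  then have "(\<lambda>k. (?g (x k) \<bullet> v k) / norm (v k) * norm (d k)) \<longlonglongrightarrow> 0"
    using D by (intro lim_null_mult_right_bounded[where B = D]) auto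
  moreover have "(?g (x k) \<bullet> v k) / norm (v k) * norm (d k) = ?g (x k) \<bullet> d k" for k
    using ls(3)[OF \<rho>, of k] \<rho> by (cases "d k = 0") (auto simp: v_def)
  ultimately have gd: "(\<lambda>k. ?g (x k) \<bullet> d k) \<longlonglongrightarrow> 0" by simp
  have "(\<lambda>k. ?g (x k) \<bullet> (d k + ?p k)) \<longlonglongrightarrow> 0"
  proof (rule tendsto_0_le[OF dp, of _ N], rule always_eventually, rule allI)
    fix k
    show "norm (?g (x k) \<bullet> (d k + ?p k)) \<le> norm (d k + ?p k) * N"
      using Cauchy_Schwarz_ineq2[of "?g (x k)" "d k + ?p k"]
        mult_right_mono[OF N[of k], of "norm (d k + ?p k)"] by (simp add: mult.commute)
  qed
  from tendsto_diff[OF this gd] have "(\<lambda>k. ?g (x k) \<bullet> ?p k) \<longlonglongrightarrow> 0" by (simp add: inner_add_right)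
  then have "(\<lambda>k. ereal (?g (x k) \<bullet> ?p k)) \<longlonglongrightarrow> ereal 0" by simp
  then have "liminf (\<lambda>k. ereal (?g (x k) \<bullet> ?p k)) = 0"
    using lim_imp_Liminf[OF sequentially_bot] unfolding zero_ereal_def by blast
  then show ?thesis by (rule disjI2)
qed

end
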